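(* Let $s\geq 0$ be a fixed integer and $G(q,s)=\sum_{n\geq 0} ac(n,s)q^n$. Then for $|q|<1$, \[G(q,s)=\frac{2^{\lfloor s/2\rfloor}q^{\lfloor 3s/2\rfloor}}{(1-q)^s(1+q)^{\lfloor s/2\rfloor}}.\]
   Context: A composition of $n$ of length $s$ is a sequence $\sigma=(\sigma_1,\ldots,\sigma_s)$ of positive integers with $\sum_i\sigma_i=n$; the empty composition is the unique composition of $0$, of length $0$. A composition is anti-palindromic if $\sigma_i\neq\sigma_{s-i+1}$ for all $i$ with $i\neq\frac{s+1}{2}$ (the empty composition is vacuously anti-palindromic). $ac(n,s)$ denotes the number of anti-palindromic compositions of $n$ of length $s$. *)

theory Defs
  imports "HOL-Analysis.Analysis"
begin

definition compositions :: "nat \<Rightarrow> nat \<Rightarrow> nat list set" where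
  "compositions n s = {\<sigma>. length \<sigma> = s \<and> (\<forall>x\<in>set \<sigma>. 0 < x) \<and> sum_list \<sigma> = n}"

text \<open>
  With parts \<open>\<sigma>\<^sub>1, \<dots>, \<sigma>\<^sub>s\<close> numbered from 1, \<open>\<sigma>\<^sub>i\<close> is the list entry
  at position \<open>i - 1\<close> and \<open>\<sigma>\<close> at \<open>s - i + 1\<close> is the entry at position \<open>s - i\<close>;
  both subtractions are exact for \<open>1 \<le> i \<le> s\<close>. The condition \<open>i \<noteq> (s + 1) / 2\<close>
  is multiplied out.
\<close>

definition antipalindromic :: "nat list \<Rightarrow> bool" where
  "antipalindromic \<sigma> \<longleftrightarrow>
     (\<forall>i\<in>{1..length \<sigma>}. 2 * i \<noteq> length \<sigma> + 1 \<longrightarrow> \<sigma> ! (i - 1) \<noteq> \<sigma> ! (length \<sigma> - i))"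

definition ac :: "nat \<Rightarrow> nat \<Rightarrow> nat" where
  "ac n s = card {\<sigma> \<in> compositions n s. antipalindromic \<sigma>}"

text \<open>The set counted by \<open>ac\<close> is finite, so its \<open>card\<close> is a genuine count.\<close>

lemma finite_compositions: "finite (compositions n s)"
proof (rule finite_subset)
  show "compositions n s \<subseteq> {\<sigma>. set \<sigma> \<subseteq> {..n} \<and> length \<sigma> = s}"
    by (auto simp: compositions_def intro: member_le_sum_list)
  show "finite {\<sigma>::nat list. set \<sigma> \<subseteq> {..n} \<and> length \<sigma> = s}"
    by (rule finite_lists_length_eq) simp
qed

text \<open>\<open>suminf\<close> is only meaningful for summable series; convergence has to be stated separately.\<close>

definition G :: "complex \<Rightarrow> nat \<Rightarrow> complex" where
  "G q s = (\<Sum>n. of_nat (ac n s) * q ^ n)"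

end

theory Submission
  imports Defs
begin

text \<open>
  Removing the first and last entry of an anti-palindromic composition of length \<open>s + 2\<close> leaves
  an anti-palindromic composition of length \<open>s\<close>, and the removed pair is an arbitrary pair of
  distinct positive integers. Hence, the generating function over all anti-palindromic
  compositions of length \<open>s\<close> gains, from \<open>s\<close> to \<open>s + 2\<close>, the factor
  \<open>(q / (1 - q))\<^sup>2 - q\<^sup>2 / (1 - q\<^sup>2) = 2 q\<^sup>3 / ((1 - q)\<^sup>2 (1 + q))\<close>,
  the sum over all pairs minus the sum over the diagonal.
\<close>

text \<open>Unordered summability of a complex family is absolute, so the norms of the products are
  summable on the rectangle. This justifies evaluating the double sum iteratively.\<close>

lemma has_sum_mult_Times:
  fixes f :: "'a \<Rightarrow> complex" and g :: "'b \<Rightarrow> complex"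
  assumes f: "(f has_sum a) A" and g: "(g has_sum b) B"
  shows "((\<lambda>(x, y). f x * g y) has_sum (a * b)) (A \<times> B)"
proof (rule has_sum_SigmaI)
  show "((\<lambda>y. case (x, y) of (x, y) \<Rightarrow> f x * g y) has_sum f x * b) B" for x
    using has_sum_cmult_right[OF g] by simp
  show "((\<lambda>x. f x * b) has_sum a * b) A"
    using has_sum_cmult_left[OF f] .
  have fa: "(\<lambda>x. norm (f x)) summable_on A" and ga: "(\<lambda>x. norm (g x)) summable_on B"
    using f g summable_on_iff_abs_summable_on_complex
    by (auto simp: summable_on_def)
  have "(\<lambda>p. norm (case p of (x, y) \<Rightarrow> f x * g y)) summable_on A \<times> B"
  proof (rule summable_on_SigmaI)
    show "((\<lambda>y. norm (case (x, y) of (x, y) \<Rightarrow> f x * g y)) has_sum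
            norm (f x) * (\<Sum>\<^sub>\<infinity>y\<in>B. norm (g y))) B" for x
      using has_sum_cmult_right[OF has_sum_infsum[OF ga]] by (simp add: norm_mult)
    show "(\<lambda>x. norm (f x) * (\<Sum>\<^sub>\<infinity>y\<in>B. norm (g y))) summable_on A"
      using fa by (rule summable_on_cmult_left)
  qed simp
  then show "(\<lambda>(x, y). f x * g y) summable_on A \<times> B"
    by (rule abs_summable_summable)
qed

text \<open>The total is left free, so that the generating function becomes a single sum of
  \<open>q ^ sum_list \<sigma>\<close> over lists.\<close>

definition antipal_compositions :: "nat \<Rightarrow> nat list set" where
  "antipal_compositions s = {\<sigma>. length \<sigma> = s \<and> (\<forall>x\<in>set \<sigma>. 0 < x) \<and> antipalindromic \<sigma>}"

lemma antipalindromic_Cons_snoc: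
  "antipalindromic (a # \<sigma> @ [b]) \<longleftrightarrow> a \<noteq> b \<and> antipalindromic \<sigma>"
proof -
  let ?n = "length \<sigma>" and ?l = "a # \<sigma> @ [b]"
  \<comment> \<open>The two extreme positions are never the middle one, and both compare
    \<open>a\<close> with \<open>b\<close>. An inner position \<open>Suc i\<close> is the middle of
    \<open>?l\<close> exactly when \<open>i\<close> is the middle of
    \<open>\<sigma>\<close>.\<close>
  have ends: "{1..length ?l} = insert 1 (insert (?n + 2) (Suc ` {1..?n}))"
    by (auto simp: image_Suc_atLeastAtMost)
  have inner: "?l ! (Suc i - 1) = \<sigma> ! (i - 1)" "?l ! (length ?l - Suc i) = \<sigma> ! (?n - i)"
    if "i \<in> {1..?n}" for i
    using that by (auto simp: nth_Cons nth_append Suc_diff_le split: nat.splits)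
  have "antipalindromic ?l \<longleftrightarrow> a \<noteq> b \<and>
      (\<forall>i\<in>{1..?n}. 2 * Suc i \<noteq> length ?l + 1 \<longrightarrow>
        ?l ! (Suc i - 1) \<noteq> ?l ! (length ?l - Suc i))"
    unfolding antipalindromic_def ends ball_simps
    by (simp add: nth_append eq_commute[of b a] conj_assoc[symmetric] del: One_nat_def)
  also have "\<dots> \<longleftrightarrow> a \<noteq> b \<and> antipalindromic \<sigma>"
    unfolding antipalindromic_def using inner by (intro conj_cong refl ball_cong) auto
  finally show ?thesis .
qed

lemma has_sum_distinct_pairs:
  fixes q :: complex
  assumes q: "norm q < 1"
  shows "((\<lambda>(a, b). q ^ (a + b)) has_sum (2 * q ^ 3 / ((1 - q)\<^sup>2 * (1 + q))))
           {(a, b). 0 < a \<and> 0 < b \<and> a \<noteq> b}"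
proof -
  have ne: "1 - q \<noteq> 0" "1 + q \<noteq> 0" "1 - q\<^sup>2 \<noteq> 0"
    using q by (auto simp: add_eq_0_iff power2_eq_1_iff)
  let ?D = "(\<lambda>a. (a, a)) ` {1::nat..}"
  \<comment> \<open>The diagonal pair \<open>(a, a)\<close> has weight
    \<open>(q\<^sup>2) ^ a\<close>, which gives a geometric series in
    \<open>q\<^sup>2\<close>.\<close>
  have "((\<lambda>a. (q\<^sup>2) ^ a) has_sum (q\<^sup>2 / (1 - q\<^sup>2))) {1..}"
    using q by (intro has_sum_geometric_from_1) (simp add: norm_power power_less_one_iff)
  then have diag: "((\<lambda>(a, b). q ^ (a + b)) has_sum (q\<^sup>2 / (1 - q\<^sup>2))) ?D"
    by (subst has_sum_reindex)
      (auto simp: inj_on_def o_def mult_2 simp flip: power_mult)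
  have all: "((\<lambda>(a, b). q ^ (a + b)) has_sum (q / (1 - q) * (q / (1 - q)))) ({1..} \<times> {1..})"
    unfolding power_add
    by (intro has_sum_mult_Times has_sum_geometric_from_1 q)
  have "q / (1 - q) * (q / (1 - q)) - q\<^sup>2 / (1 - q\<^sup>2) = 2 * q ^ 3 / ((1 - q)\<^sup>2 * (1 + q))"
  proof -
    have "1 - q\<^sup>2 = (1 - q) * (1 + q)"
      by algebra
    then show ?thesis
      using ne by (simp add: divide_simps) (simp add: power2_eq_square power3_eq_cube algebra_simps)
  qed
  moreover have "{1..} \<times> {1..} - ?D = {(a, b). 0 < a \<and> 0 < b \<and> a \<noteq> b}"
    by auto
  ultimately show ?thesis
    using has_sum_Diff[OF all diag] by auto
qed

lemma has_sum_antipal_compositions: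
  fixes q :: complex
  assumes q: "norm q < 1"
  shows "((\<lambda>\<sigma>. q ^ sum_list \<sigma>) has_sum
           (2 ^ (s div 2) * q ^ (3 * s div 2) / ((1 - q) ^ s * (1 + q) ^ (s div 2))))
           (antipal_compositions s)"
proof (induction s rule: nat_induct2)
  case 0
  have "antipal_compositions 0 = {[]}"
    by (auto simp: antipal_compositions_def antipalindromic_def)
  then show ?case
    by (simp add: has_sum_finite_iff)
next
  case 1
  \<comment> \<open>A single part is the middle part and hence unconstrained, so every
    \<open>[n]\<close> with \<open>n\<close> positive occurs.\<close>
  have "((\<lambda>\<sigma>. q ^ sum_list \<sigma>) has_sum q / (1 - q)) (antipal_compositions 1) \<longleftrightarrow>
        ((\<lambda>n. q ^ n) has_sum q / (1 - q)) {1..}"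
    by (rule has_sum_reindex_bij_witness[of _ "\<lambda>n. [n]" hd])
      (auto simp: antipal_compositions_def antipalindromic_def length_Suc_conv)
  then show ?case
    using has_sum_geometric_from_1[OF q] by simp
next
  case (step s)
  let ?P = "{(a, b). 0 < a \<and> 0 < b \<and> a \<noteq> (b::nat)}"
  let ?F = "\<lambda>s. 2 ^ (s div 2) * q ^ (3 * s div 2) / ((1 - q) ^ s * (1 + q) ^ (s div 2))"
  have split: "\<exists>a \<tau> b. \<sigma> = a # \<tau> @ [b] \<and> length \<tau> = s" if len: "length \<sigma> = s + 2" for \<sigma> :: "nat list"
  proof -
    obtain a \<rho> where "\<sigma> = a # \<rho>" "length \<rho> = Suc s"
      using len by (cases \<sigma>) auto
    then show ?thesis
      by (cases \<rho> rule: rev_cases) auto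
  qed
  \<comment> \<open>Steps of two keep the parity of \<open>s\<close>, so the floors grow by exactly
    1 and 3, matching the factor 2 and the power \<open>q ^ 3\<close> contributed by the outer
    pair.\<close>
  have exps: "(s + 2) div 2 = s div 2 + 1" "3 * (s + 2) div 2 = 3 * s div 2 + 3"
    by simp_all
  have "((\<lambda>\<sigma>. q ^ sum_list \<sigma>) has_sum ?F (s + 2)) (antipal_compositions (s + 2)) \<longleftrightarrow>
        ((\<lambda>(p, \<tau>). (case p of (a, b) \<Rightarrow> q ^ (a + b)) * q ^ sum_list \<tau>) has_sum
          2 * q ^ 3 / ((1 - q)\<^sup>2 * (1 + q)) * ?F s) (?P \<times> antipal_compositions s)"
  proof (rule has_sum_reindex_bij_witness[of _ "\<lambda>((a, b), \<tau>). a # \<tau> @ [b]"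
        "\<lambda>\<sigma>. ((hd \<sigma>, last \<sigma>), butlast (tl \<sigma>))"], goal_cases)
    case (1 \<sigma>)
    then show ?case using split[of \<sigma>] by (auto simp: antipal_compositions_def)
  next
    case (2 \<sigma>)
    then show ?case
      using split[of \<sigma>] by (auto simp: antipal_compositions_def antipalindromic_Cons_snoc)
  next
    case (3 p)
    then show ?case by auto
  next
    case (4 p)
    then show ?case by (auto simp: antipal_compositions_def antipalindromic_Cons_snoc)
  next
    case (5 \<sigma>)
    then show ?case
      using split[of \<sigma>] by (auto simp: antipal_compositions_def power_add)
  next
    \<comment> \<open>The two claimed sums agree.\<close>
    case 6
    show ?case
      unfolding exps power_add by (simp add: mult_ac)
  qed
  then show ?case
    using has_sum_mult_Times[OF has_sum_distinct_pairs[OF q] step] by simp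
qed

text \<open>Grouping the lists by their total \<open>n\<close> gives finite fibres with
  \<open>ac n s\<close> elements, on each of which the summand is constantly
  \<open>q ^ n\<close>.\<close>

lemma has_sum_ac:
  fixes q :: complex
  assumes "((\<lambda>\<sigma>. q ^ sum_list \<sigma>) has_sum S) (antipal_compositions s)"
  shows "((\<lambda>n. of_nat (ac n s) * q ^ n) has_sum S) UNIV"
proof (rule has_sum_SigmaD)
  let ?C = "\<lambda>n. {\<sigma> \<in> compositions n s. antipalindromic \<sigma>}"
  \<comment> \<open>Tagging each list with its total identifies
    \<open>antipal_compositions s\<close> with the disjoint union of the fibres.\<close>
  show "((\<lambda>(n, \<sigma>). q ^ n) has_sum S) (Sigma UNIV ?C)"
    using assms
    by (subst has_sum_reindex_bij_witness[of _ "\<lambda>\<sigma>. (sum_list \<sigma>, \<sigma>)" snd])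
      (auto simp: compositions_def antipal_compositions_def)
  show "((\<lambda>\<sigma>. case (n, \<sigma>) of (n, \<sigma>) \<Rightarrow> q ^ n) has_sum of_nat (ac n s) * q ^ n) (?C n)" for n
    by (rule has_sum_finiteI) (simp_all add: ac_def finite_compositions)
qed

theorem theorem3:
  fixes s :: nat and q :: complex
  assumes "norm q < 1"
  shows "summable (\<lambda>n. of_nat (ac n s) * q ^ n) \<and>
         G q s = 2 ^ (s div 2) * q ^ (3 * s div 2) / ((1 - q) ^ s * (1 + q) ^ (s div 2))"
  \<comment> \<open>An unordered sum over all naturals is also the limit of the partial sums, which
    yields both convergence and value.\<close>
  using has_sum_imp_sums[OF has_sum_ac[OF has_sum_antipal_compositions[OF assms]]]
  unfolding G_def by (auto simp: sums_iff)

end
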